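(* Let $G$ be a metric graph with $n$ vertices and vertex weights in $(0,1]$, some vertex having weight $1$. The algorithm BrutePartitionAlg, applied to $G$, constructs a walk $S$ of size $O(n\rho_G)$ such that $\Delta(S)$ is an $O(\log\rho_G)$-approximation for the min-max latency walk problem in $G$, i.e. $C(\Delta(S))\le \alpha\,\mathrm{OPT}_G$ with $\alpha\in O(\log\rho_G)$.
   Context: A metric graph is a complete undirected graph with positive edge lengths satisfying the triangle inequality; $\rho_G$ is the ratio of maximum to minimum vertex weight. A walk of size $k$ is a sequence of $k$ vertices; its length $l(\cdot)$ is the sum of its edge lengths; $[W_1,\dots,W_m]$ is concatenation; $\Delta(S)=[S,S,\dots]$. For $V'\subseteq V(G)$, $G[V']$ is the induced subgraph. $\text{TSP-Path}(H)$ is the walk formed by the first $|V(H)|$ vertices of a minimum-length tour of $H$ visiting each vertex exactly once. $\mathrm{Partition}(W,k)$ splits a walk $W$ into $k$ consecutive pieces $W_0,\dots,W_{k-1}$ (some possibly empty) partitioning the entries of $W$, each of length at most $l(W)/k$. BrutePartitionAlg$(G)$: for $0\le i\le\lceil\log_2\rho_G\rceil$ let $V_i=\{u:1/2^i\le\phi(u)<1/2^{i-1}\}$; let $t=2^{\lceil\log_2\rho_G\rceil+1}$ and $S_1=\dots=S_t=\emptyset$; for each $i=0,\dots,\lceil\log_2\rho_G\rceil$, compute $\{W_{i,0},\dots,W_{i,2^i-1}\}=\mathrm{Partition}(\text{TSP-Path}(G[V_i]),2^i)$ and for each $k=1,\dots,t$ set $S_k\leftarrow[S_k,W_{i,k\bmod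 2^i}]$; output $S=[S_1,\dots,S_t]$. For an infinite walk $W$, the latency $L(W,v)$ is the maximum length of the sub-walk between consecutive occurrences of $v$ ($+\infty$ if $v$ does not occur infinitely often); the cost is $C(W)=\max_v\phi(v)L(W,v)$; $\mathrm{OPT}_G$ is the minimum cost over all infinite walks. *)

theory Defs
  imports Complex_Main "HOL-Library.Extended_Real" "HOL-Library.Landau_Symbols"
begin

record 'a weighted_graph =
  verts :: "'a set"
  len :: "'a \<Rightarrow> 'a \<Rightarrow> real"
  wt :: "'a \<Rightarrow> real"

text \<open>
  Every pair of distinct vertices is an edge. The diagonal of \<open>len\<close> carries no edge; it is set to
  0 because the walks built by the algorithm may list the same vertex twice in a row.
\<close>

definition metric_graph :: "'a weighted_graph \<Rightarrow> bool" where
  "metric_graph G \<longleftrightarrow>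
     finite (verts G) \<and> verts G \<noteq> {} \<and>
     (\<forall>u\<in>verts G. len G u u = 0) \<and>
     (\<forall>u\<in>verts G. \<forall>v\<in>verts G. u \<noteq> v \<longrightarrow> 0 < len G u v) \<and>
     (\<forall>u\<in>verts G. \<forall>v\<in>verts G. len G u v = len G v u) \<and>
     (\<forall>u\<in>verts G. \<forall>v\<in>verts G. \<forall>w\<in>verts G. len G u w \<le> len G u v + len G v w)"

definition weight_ratio :: "'a weighted_graph \<Rightarrow> real" where
  "weight_ratio G = Max (wt G ` verts G) / Min (wt G ` verts G)"

definition induced :: "'a weighted_graph \<Rightarrow> 'a set \<Rightarrow> 'a weighted_graph" where
  "induced G U = G\<lparr>verts := verts G \<inter> U\<rparr>"

definition walk :: "'a weighted_graph \<Rightarrow> 'a list \<Rightarrow> bool" where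
  "walk G W \<longleftrightarrow> set W \<subseteq> verts G"

definition walk_length :: "'a weighted_graph \<Rightarrow> 'a list \<Rightarrow> real" where
  "walk_length G W = (\<Sum>i<length W - 1. len G (W ! i) (W ! Suc i))"

definition infinite_walk :: "'a weighted_graph \<Rightarrow> (nat \<Rightarrow> 'a) \<Rightarrow> bool" where
  "infinite_walk G W \<longleftrightarrow> (\<forall>i. W i \<in> verts G)"

text \<open>The walk \<open>\<Delta>(S) = [S, S, \<dots>]\<close>, meaningful for nonempty \<open>S\<close>.\<close>

definition repeat_walk :: "'a list \<Rightarrow> nat \<Rightarrow> 'a" where
  "repeat_walk S i = S ! (i mod length S)"

text \<open>
  The maximum is a supremum in the extended reals, so unbounded return lengths give \<open>\<infinity>\<close>.
  The part of the walk before the first occurrence of \<open>v\<close> does not count.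
\<close>

definition latency :: "'a weighted_graph \<Rightarrow> (nat \<Rightarrow> 'a) \<Rightarrow> 'a \<Rightarrow> ereal" where
  "latency G W v =
     (if infinite {i. W i = v}
      then Sup {ereal (walk_length G (map W [i..<Suc j])) | i j.
                  i < j \<and> W i = v \<and> W j = v \<and> (\<forall>k. i < k \<and> k < j \<longrightarrow> W k \<noteq> v)}
      else \<infinity>)"

definition cost :: "'a weighted_graph \<Rightarrow> (nat \<Rightarrow> 'a) \<Rightarrow> ereal" where
  "cost G W = (SUP v\<in>verts G. ereal (wt G v) * latency G W v)"

definition opt :: "'a weighted_graph \<Rightarrow> ereal" where
  "opt G = (INF W\<in>{W. infinite_walk G W}. cost G W)"

definition approx_solution :: "'a weighted_graph \<Rightarrow> real \<Rightarrow> (nat \<Rightarrow> 'a) \<Rightarrow> bool" where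
  "approx_solution G a W \<longleftrightarrow> infinite_walk G W \<and> cost G W \<le> ereal a * opt G"

text \<open>
  A tour is a closed walk: its last entry repeats its first one, and apart from this repetition
  each vertex occurs exactly once. The only tour of the empty graph is the empty list.
\<close>

definition tour :: "'a weighted_graph \<Rightarrow> 'a list \<Rightarrow> bool" where
  "tour G T \<longleftrightarrow> walk G T \<and> distinct (butlast T) \<and> set (butlast T) = verts G \<and>
     (T \<noteq> [] \<longrightarrow> last T = hd T)"

definition min_tour :: "'a weighted_graph \<Rightarrow> 'a list \<Rightarrow> bool" where
  "min_tour G T \<longleftrightarrow> tour G T \<and> (\<forall>T'. tour G T' \<longrightarrow> walk_length G T \<le> walk_length G T')"

text \<open>
  TSP-Path, Partition and the algorithm leave choices open (which optimal tour, where it starts,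
  where to cut), so each is a relation between its input and its possible outputs.
\<close>

definition tsp_path :: "'a weighted_graph \<Rightarrow> 'a list \<Rightarrow> bool" where
  "tsp_path G P \<longleftrightarrow> (\<exists>T. min_tour G T \<and> P = take (card (verts G)) T)"

definition walk_partition :: "'a weighted_graph \<Rightarrow> 'a list \<Rightarrow> nat \<Rightarrow> 'a list list \<Rightarrow> bool" where
  "walk_partition G W k Ws \<longleftrightarrow> length Ws = k \<and> concat Ws = W \<and>
     (\<forall>j<k. walk_length G (Ws ! j) \<le> walk_length G W / real k)"

definition weight_class :: "'a weighted_graph \<Rightarrow> nat \<Rightarrow> 'a set" where
  "weight_class G i =
     {u \<in> verts G. 1 / 2 ^ i \<le> wt G u \<and> wt G u < 1 / 2 powi (int i - 1)}"

definition brute_partition_alg :: "'a weighted_graph \<Rightarrow> 'a list \<Rightarrow> bool" where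
  "brute_partition_alg G S \<longleftrightarrow>
     (let m = nat \<lceil>log 2 (weight_ratio G)\<rceil>; t = 2 ^ (m + 1) in
      \<exists>P Ws.
        (\<forall>i\<le>m. tsp_path (induced G (weight_class G i)) (P i) \<and>
                walk_partition G (P i) (2 ^ i) (Ws i)) \<and>
        S = concat (map (\<lambda>k. concat (map (\<lambda>i. Ws i ! (k mod 2 ^ i)) [0..<m + 1])) [1..<t + 1]))"

end

theory Submission
  imports Defs "HOL-Library.Sublist"
begin

text \<open>
  Let \<open>c\<close> be the cost of an arbitrary infinite walk. It returns to the vertex of weight 1 within length
  \<open>c\<close>, so the diameter is at most \<open>c\<close>; it returns to each vertex of weight at least \<open>1 / 2 ^ i\<close> within
  length \<open>2 ^ i * c\<close>, so some segment of this length covers the whole \<open>i\<close>-th weight class, and shortcutting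
  and closing it gives a tour of length at most \<open>2 * 2 ^ i * c\<close>. Hence each of the \<open>2 ^ i\<close> pieces of that
  class has length at most \<open>2 * c\<close>, and each \<open>S\<^sub>k\<close>, including the connecting edges, has length \<open>O(m * c)\<close>,
  where \<open>m\<close> is the number of classes. A vertex of the \<open>i\<close>-th class recurs after \<open>2 ^ i\<close> consecutive
  \<open>S\<^sub>k\<close> and has weight less than \<open>2 / 2 ^ i\<close>, so its weighted latency is \<open>O(m * c)\<close>.
\<close>

section \<open>Lengths of finite walks\<close>

lemma walk_length_Nil [simp]: "walk_length G [] = 0"
  and walk_length_single [simp]: "walk_length G [x] = 0"
  by (simp_all add: walk_length_def)

lemma walk_length_Cons_Cons [simp]:
  "walk_length G (x # y # zs) = len G x y + walk_length G (y # zs)"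
  by (simp add: walk_length_def sum.lessThan_Suc_shift del: sum.lessThan_Suc)

lemma walk_length_induced [simp]: "walk_length (induced G U) W = walk_length G W"
  by (simp add: walk_length_def induced_def)

text \<open>The vertex \<open>hd ys\<close> is shared: it ends the first walk and begins the second,
  so no edge is lost or counted twice.\<close>

lemma walk_length_append_hd:
  "ys \<noteq> [] \<Longrightarrow> walk_length G (xs @ ys) = walk_length G (xs @ [hd ys]) + walk_length G ys"
proof (induction xs)
  case Nil
  then show ?case by simp
next
  case (Cons x xs)
  then show ?case by (cases xs; cases ys) auto
qed

lemma walk_length_snoc:
  "xs \<noteq> [] \<Longrightarrow> walk_length G (xs @ [y]) = walk_length G xs + len G (last xs) y"
proof (induction xs)
  case Nil
  then show ?case by simp
next
  case (Cons x xs)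
  then show ?case by (cases xs) auto
qed

text \<open>Cut just before the first vertex that overruns \<open>b\<close>. The induction goes from
  the right because vertices appended after a cut leave it in place.\<close>

lemma greedy_prefix:
  assumes "0 \<le> b"
  shows "\<exists>xs ys. W = xs @ ys \<and> walk_length G xs \<le> b \<and>
           (ys = [] \<or> b < walk_length G (xs @ [hd ys]))"
proof (induction W rule: rev_induct)
  case Nil
  then show ?case using assms by simp
next
  case (snoc x W)
  then obtain xs ys where IH: "W = xs @ ys" "walk_length G xs \<le> b"
    "ys = [] \<or> b < walk_length G (xs @ [hd ys])" by blast
  show ?case
  proof (cases "ys = []")
    case True
    show ?thesis
    proof (cases "walk_length G (W @ [x]) \<le> b")
      case True
      then show ?thesis by (intro exI[of _ "W @ [x]"] exI[of _ "[]"]) simp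
    next
      case False
      then show ?thesis using IH True by (intro exI[of _ W] exI[of _ "[x]"]) simp
    qed
  next
    case False
    then show ?thesis using IH by (intro exI[of _ xs] exI[of _ "ys @ [x]"]) simp
  qed
qed

text \<open>Cut greedily. A cut drops the edge from the prefix to the rest, and the prefix with that
  edge exceeds \<open>b\<close>; so each cut uses up a full share of the length, and the rest fits
  into one piece fewer.\<close>

lemma bounded_pieces_exist:
  assumes "0 \<le> b" "walk_length G W \<le> real (Suc k) * b"
  shows "\<exists>Ws. length Ws = Suc k \<and> concat Ws = W \<and> (\<forall>X\<in>set Ws. walk_length G X \<le> b)"
  using assms(2)
proof (induction k arbitrary: W)
  case 0
  then show ?case by (intro exI[of _ "[W]"]) simp
next
  case (Suc k)
  obtain xs ys where W: "W = xs @ ys" "walk_length G xs \<le> b"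
    and ys: "ys = [] \<or> b < walk_length G (xs @ [hd ys])"
    using greedy_prefix[OF assms(1)] by metis
  have "walk_length G ys \<le> real (Suc k) * b"
  proof (cases "ys = []")
    case True
    then show ?thesis using assms(1) by simp
  next
    case False
    then have "walk_length G W = walk_length G (xs @ [hd ys]) + walk_length G ys"
      using W walk_length_append_hd by metis
    then show ?thesis using Suc.prems ys False by (simp add: algebra_simps)
  qed
  from Suc.IH[OF this] obtain Ws where
    "length Ws = Suc k" "concat Ws = ys" "\<forall>X\<in>set Ws. walk_length G X \<le> b" by blast
  then show ?case using W by (intro exI[of _ "xs # Ws"]) simp
qed

lemma sum_atLeastLessThan_mono_interval:
  fixes f :: "nat \<Rightarrow> real"
  assumes "\<And>l. 0 \<le> f l" "a \<le> i" "j \<le> b"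
  shows "sum f {i..<j} \<le> sum f {a..<b}"
  using assms by (intro sum_mono2) auto

lemma walk_length_map_upt:
  "walk_length G (map R [a..<b]) = (\<Sum>l=a..<b - 1. len G (R l) (R (Suc l)))"
proof -
  have "walk_length G (map R [a..<b]) = (\<Sum>i<b - 1 - a. len G (R (a + i)) (R (a + Suc i)))"
    unfolding walk_length_def by (intro sum.cong) auto
  also have "\<dots> = (\<Sum>l=a..<b - 1. len G (R l) (R (Suc l)))"
    by (rule sum.reindex_bij_witness[of _ "\<lambda>l. l - a" "\<lambda>i. a + i"]) auto
  finally show ?thesis .
qed

section \<open>Shortcutting and joining walks in a metric graph\<close>

locale metric_weighted_graph =
  fixes G :: "'a weighted_graph"
  assumes metric: "metric_graph G"
begin

lemma finite_verts: "finite (verts G)"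
  and verts_nonempty: "verts G \<noteq> {}"
  and len_self: "u \<in> verts G \<Longrightarrow> len G u u = 0"
  and len_sym: "u \<in> verts G \<Longrightarrow> v \<in> verts G \<Longrightarrow> len G u v = len G v u"
  and len_triangle: "u \<in> verts G \<Longrightarrow> v \<in> verts G \<Longrightarrow> w \<in> verts G \<Longrightarrow>
    len G u w \<le> len G u v + len G v w"
  using metric unfolding metric_graph_def by blast+

lemma len_nonneg: "u \<in> verts G \<Longrightarrow> v \<in> verts G \<Longrightarrow> 0 \<le> len G u v"
  using metric unfolding metric_graph_def by (metis less_eq_real_def)

lemma walk_length_nonneg:
  assumes "set xs \<subseteq> verts G"
  shows "0 \<le> walk_length G xs"
  unfolding walk_length_def using assms
  by (intro sum_nonneg len_nonneg) (auto simp: subset_iff)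

text \<open>The common start \<open>x\<close> makes the induction work: a vertex skipped right after
  \<open>x\<close> is bypassed by one use of the triangle inequality.\<close>

lemma walk_length_Cons_subseq:
  assumes "subseq ys xs" "set xs \<subseteq> verts G" "x \<in> verts G"
  shows "walk_length G (x # ys) \<le> walk_length G (x # xs)"
  using assms
proof (induction arbitrary: x rule: list_emb.induct)
  case (list_emb_Nil ys)
  then show ?case using walk_length_nonneg[of "x # ys"] by simp
next
  case (list_emb_Cons ys xs y)
  have "walk_length G (x # ys) \<le> walk_length G (x # xs)"
    using list_emb_Cons by simp
  also have "\<dots> \<le> walk_length G (x # y # xs)"
  proof (cases xs)
    case Nil
    then show ?thesis using list_emb_Cons.prems len_nonneg by simp
  next
    case (Cons z zs)
    then show ?thesis using list_emb_Cons.prems len_triangle[of x y z] by simp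
  qed
  finally show ?case .
next
  case (list_emb_Cons2 x' y' ys xs)
  then show ?case by simp
qed

text \<open>A subsequence need not keep the first vertex; the part of \<open>xs\<close> before the
  first kept vertex only adds nonnegative length.\<close>

lemma walk_length_subseq:
  assumes "subseq ys xs" "set xs \<subseteq> verts G"
  shows "walk_length G ys \<le> walk_length G xs"
proof (cases ys)
  case Nil
  then show ?thesis using walk_length_nonneg assms by simp
next
  case (Cons y ys')
  then have y: "y \<in> verts G"
    using assms by (metis list.set_intros(1) notin_set_nthsI subset_iff subseq_conv_nths)
  obtain us vs where xs: "xs = us @ y # vs" "subseq ys' vs"
    using assms(1) Cons by (auto dest: list_emb_ConsD)
  have "walk_length G ys \<le> walk_length G (y # vs)"
    using walk_length_Cons_subseq[OF xs(2)] assms(2) xs(1) Cons by simp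
  also have "\<dots> \<le> walk_length G (us @ [y]) + walk_length G (y # vs)"
    using walk_length_nonneg[of "us @ [y]"] assms(2) xs(1) by simp
  also have "\<dots> = walk_length G xs"
    unfolding xs(1) using walk_length_append_hd[of "y # vs" G us] by simp
  finally show ?thesis .
qed

lemma walk_length_append_le:
  assumes "set xs \<subseteq> verts G" "set ys \<subseteq> verts G" "0 \<le> D"
    and diam: "\<And>u v. u \<in> verts G \<Longrightarrow> v \<in> verts G \<Longrightarrow> len G u v \<le> D"
  shows "walk_length G (xs @ ys) \<le> walk_length G xs + D + walk_length G ys"
proof (cases "xs = [] \<or> ys = []")
  case True
  then show ?thesis using assms(3) by auto
next
  case False
  then have "walk_length G (xs @ ys) = walk_length G xs + len G (last xs) (hd ys) + walk_length G ys"
    using walk_length_append_hd[of ys G xs] walk_length_snoc[of xs G "hd ys"] by simp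
  moreover have "len G (last xs) (hd ys) \<le> D"
    using False assms(1,2) by (intro diam) auto
  ultimately show ?thesis by simp
qed

lemma walk_length_concat_le:
  assumes "0 \<le> D" "\<And>u v. u \<in> verts G \<Longrightarrow> v \<in> verts G \<Longrightarrow> len G u v \<le> D"
    and "\<And>X. X \<in> set Ls \<Longrightarrow> set X \<subseteq> verts G"
  shows "walk_length G (concat Ls) \<le> (\<Sum>X\<leftarrow>Ls. walk_length G X + D)"
  using assms(3)
proof (induction Ls)
  case Nil
  then show ?case by simp
next
  case (Cons X Ls)
  have "walk_length G (X @ concat Ls) \<le> walk_length G X + D + walk_length G (concat Ls)"
    using Cons.prems by (intro walk_length_append_le[OF _ _ assms(1,2)]) (auto simp: UN_subset_iff)
  then show ?case using Cons by simp
qed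

end

section \<open>Tours and partitions\<close>

lemma subseq_remdups: "subseq (remdups xs) xs"
  by (induction xs) auto

lemma tour_length_butlast:
  assumes "tour H T"
  shows "length (butlast T) = card (verts H)" "butlast T = take (card (verts H)) T"
proof -
  show *: "length (butlast T) = card (verts H)"
    using assms distinct_card[of "butlast T"] by (simp add: tour_def)
  show "butlast T = take (card (verts H)) T"
    unfolding *[symmetric] by (simp add: butlast_conv_take)
qed

lemma tsp_pathE:
  assumes "tsp_path H P"
  obtains T where "min_tour H T" "P = butlast T" "set P = verts H" "length P = card (verts H)"
proof -
  from assms obtain T where T: "min_tour H T" "P = take (card (verts H)) T"
    unfolding tsp_path_def by blast
  then have "tour H T" by (simp add: min_tour_def)
  note butlast = tour_length_butlast[OF this]
  have "P = butlast T" using T(2) butlast(2) by simp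
  moreover from this have "set P = verts H" using \<open>tour H T\<close> by (simp add: tour_def)
  moreover have "length P = card (verts H)"
    unfolding \<open>P = butlast T\<close> by (rule butlast(1))
  ultimately show thesis using that T(1) by blast
qed

lemma tour_closing:
  assumes "distinct ys" "set ys = verts H" "ys \<noteq> []"
  shows "tour H (ys @ [hd ys])"
  using assms(1,3) by (simp add: tour_def walk_def assms(2)[symmetric])

text \<open>Tours have at most one entry more than there are vertices, so there are only finitely
  many of them.\<close>

lemma ex_min_tour:
  assumes "finite (verts H)"
  shows "\<exists>T. min_tour H T"
proof -
  have "{T. tour H T} \<subseteq> {xs. set xs \<subseteq> verts H \<and> length xs \<le> Suc (card (verts H))}"
    using tour_length_butlast(1) by (force simp: tour_def walk_def)
  then have "finite {T. tour H T}"
    using finite_lists_length_le[OF assms] by (rule finite_subset)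
  moreover have "\<exists>T. tour H T"
  proof (cases "verts H = {}")
    case True
    then show ?thesis by (intro exI[of _ "[]"]) (simp add: tour_def walk_def)
  next
    case False
    obtain ys where "set ys = verts H" "distinct ys"
      using finite_distinct_list[OF assms] by blast
    then show ?thesis using tour_closing False by (metis list.set(1))
  qed
  ultimately obtain T where "is_arg_min (walk_length H) (tour H) T"
    using ex_is_arg_min_if_finite[of "{T. tour H T}" "walk_length H"] by auto
  then show ?thesis by (auto simp: min_tour_def is_arg_min_linorder)
qed

context metric_weighted_graph
begin

text \<open>Keeping one occurrence in \<open>xs\<close> of each vertex of \<open>U\<close> does not
  lengthen the walk, and closing the result costs one edge of length at most \<open>D\<close>. This
  tour competes with the optimal one, of which \<open>P\<close> is a prefix.\<close>

lemma tsp_path_length_le: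
  assumes P: "tsp_path (induced G U) P" and "U \<subseteq> verts G" "U \<subseteq> set xs" "set xs \<subseteq> verts G"
    and "0 \<le> D" and diam: "\<And>u v. u \<in> verts G \<Longrightarrow> v \<in> verts G \<Longrightarrow> len G u v \<le> D"
  shows "walk_length G P \<le> walk_length G xs + D"
proof -
  have verts: "verts (induced G U) = U" using assms(2) by (auto simp: induced_def)
  obtain T where T: "min_tour (induced G U) T" "P = butlast T" "set P = U"
    using P verts by (auto elim: tsp_pathE)
  show ?thesis
  proof (cases "U = {}")
    case True
    then show ?thesis using T walk_length_nonneg[OF assms(4)] assms(5) by simp
  next
    case False
    define ys where "ys = remdups (filter (\<lambda>v. v \<in> U) xs)"
    have ys: "set ys = U" "distinct ys"
      using assms(3) by (auto simp: ys_def)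
    then have "ys \<noteq> []" using False by auto
    have "subseq ys xs"
      unfolding ys_def using subseq_remdups subseq_filter_left subseq_order.trans by blast
    then have ys_xs: "walk_length G ys \<le> walk_length G xs"
      using walk_length_subseq assms(4) by blast
    have "set T \<subseteq> verts G"
      using T(1) verts assms(2) by (auto simp: min_tour_def tour_def walk_def)
    moreover have "subseq P T"
      unfolding T(2) by (simp add: prefixeq_butlast prefix_imp_subseq)
    ultimately have "walk_length G P \<le> walk_length G T"
      using walk_length_subseq by blast
    also have "\<dots> \<le> walk_length G (ys @ [hd ys])"
      using T(1) tour_closing[of ys "induced G U"] ys \<open>ys \<noteq> []\<close> verts by (auto simp: min_tour_def)
    also have "\<dots> = walk_length G ys + len G (last ys) (hd ys)"
      using \<open>ys \<noteq> []\<close> by (rule walk_length_snoc)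
    also have "\<dots> \<le> walk_length G xs + D"
      using ys \<open>ys \<noteq> []\<close> ys_xs assms(2) by (intro add_mono diam) auto
    finally show ?thesis .
  qed
qed

lemma ex_walk_partition:
  assumes "set W \<subseteq> verts G"
  shows "\<exists>Ws. walk_partition G W (2 ^ i) Ws"
proof -
  obtain k where k: "2 ^ i = Suc k" by (metis Suc_pred' zero_less_numeral zero_less_power)
  have "0 \<le> walk_length G W / real (Suc k)"
    using walk_length_nonneg[OF assms] by simp
  from bounded_pieces_exist[OF this, where k = k] show ?thesis
    unfolding walk_partition_def k by (metis mult.commute nonzero_divide_eq_eq nth_mem of_nat_neq_0 order_refl)
qed

lemma ex_brute_partition_alg: "\<exists>S. brute_partition_alg G S"
proof -
  have "\<exists>P Ws. tsp_path (induced G (weight_class G i)) P \<and> walk_partition G P (2 ^ i) Ws" for i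
  proof -
    have "finite (verts (induced G (weight_class G i)))"
      using finite_verts by (simp add: induced_def)
    then obtain T where "min_tour (induced G (weight_class G i)) T"
      using ex_min_tour by blast
    then obtain P where P: "tsp_path (induced G (weight_class G i)) P"
      unfolding tsp_path_def by blast
    then have "set P \<subseteq> verts G" by (rule tsp_pathE) (auto simp: induced_def)
    then show ?thesis using P ex_walk_partition by blast
  qed
  then obtain P Ws where "\<And>i. tsp_path (induced G (weight_class G i)) (P i)"
    "\<And>i. walk_partition G (P i) (2 ^ i) (Ws i)" by metis
  then show ?thesis unfolding brute_partition_alg_def Let_def by blast
qed

end

section \<open>Lower bounds on the cost of an infinite walk\<close>

definition segment_length :: "'a weighted_graph \<Rightarrow> (nat \<Rightarrow> 'a) \<Rightarrow> nat \<Rightarrow> nat \<Rightarrow> real" where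
  "segment_length G W i j = (\<Sum>l=i..<j. len G (W l) (W (Suc l)))"

lemma walk_length_segment: "walk_length G (map W [i..<Suc j]) = segment_length G W i j"
  unfolding walk_length_map_upt segment_length_def by simp

lemma segment_length_split:
  "i \<le> p \<Longrightarrow> p \<le> j \<Longrightarrow> segment_length G W i j = segment_length G W i p + segment_length G W p j"
  unfolding segment_length_def by (simp add: sum.atLeastLessThan_concat)

definition consecutive :: "(nat \<Rightarrow> 'a) \<Rightarrow> 'a \<Rightarrow> nat \<Rightarrow> nat \<Rightarrow> bool" where
  "consecutive W v i j \<longleftrightarrow> i < j \<and> W i = v \<and> W j = v \<and> (\<forall>k. i < k \<and> k < j \<longrightarrow> W k \<noteq> v)"

text \<open>Replaces the extended supremum by a real bound on every gap; a real bound also rules out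
  the default value \<infinity> of \<open>latency\<close>.\<close>

lemma latency_le_iff:
  "latency G W v \<le> ereal L \<longleftrightarrow>
     infinite {i. W i = v} \<and> (\<forall>i j. consecutive W v i j \<longrightarrow> segment_length G W i j \<le> L)"
  unfolding latency_def walk_length_segment consecutive_def
  by (auto simp: Sup_le_iff intro: ereal_less_eq(3)[THEN iffD1])

text \<open>Take the last occurrence up to \<open>p\<close> and the first one after
  \<open>p\<close>; the occurrence \<open>q\<close> guarantees that the former exists.\<close>

lemma consecutive_around:
  assumes "infinite {i. W i = v}" "W q = v" "q \<le> p"
  obtains i j where "consecutive W v i j" "i \<le> p" "p < j"
proof -
  define i where "i = (GREATEST i. W i = v \<and> i \<le> p)"
  define j where "j = (LEAST j. W j = v \<and> p < j)"
  have i: "W i = v \<and> i \<le> p"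
    unfolding i_def by (rule GreatestI_nat[of _ q p]) (use assms in auto)
  obtain j' where "p < j'" "W j' = v"
    using assms(1) by (auto simp: infinite_nat_iff_unbounded)
  then have j: "W j = v \<and> p < j"
    unfolding j_def by (intro LeastI) auto
  have "W k \<noteq> v" if "i < k" "k < j" for k
  proof (cases "k \<le> p")
    case True
    then show ?thesis
      using Greatest_le_nat[of "\<lambda>i. W i = v \<and> i \<le> p" k p] that(1) unfolding i_def by auto
  next
    case False
    then show ?thesis
      using not_less_Least[of k "\<lambda>j. W j = v \<and> p < j"] that(2) unfolding j_def by auto
  qed
  then show thesis using that[of i j] i j by (auto simp: consecutive_def)
qed

text \<open>\<open>W\<close> is an arbitrary competitor and \<open>c\<close> any real bound on its
  cost, so that estimates in terms of \<open>c\<close> carry over to the infimum.\<close>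

locale walk_of_finite_cost = metric_weighted_graph +
  fixes W :: "nat \<Rightarrow> 'a" and c :: real
  assumes weights: "\<And>v. v \<in> verts G \<Longrightarrow> 0 < wt G v"
    and unit_weight: "\<exists>v\<in>verts G. wt G v = 1"
    and walk_W: "infinite_walk G W"
    and cost_W: "cost G W \<le> ereal c"
begin

lemma W_in [simp]: "W i \<in> verts G"
  using walk_W by (simp add: infinite_walk_def)

lemma latency_le:
  assumes "v \<in> verts G"
  shows "latency G W v \<le> ereal (c / wt G v)"
proof -
  have "ereal (wt G v) * latency G W v \<le> ereal c"
    using cost_W assms unfolding cost_def by (meson SUP_le_iff)
  then show ?thesis
    using weights[OF assms] by (cases "latency G W v") (auto simp: field_simps)
qed

lemma occurs_infinitely: "v \<in> verts G \<Longrightarrow> infinite {i. W i = v}"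
  and consecutive_length:
    "v \<in> verts G \<Longrightarrow> consecutive W v i j \<Longrightarrow> segment_length G W i j \<le> c / wt G v"
  using latency_le unfolding latency_le_iff by blast+

lemma occurs_after:
  assumes "v \<in> verts G"
  obtains p where "a \<le> p" "W p = v"
  using occurs_infinitely[OF assms] by (auto simp: infinite_nat_iff_unbounded_le)

lemma segment_length_nonneg: "0 \<le> segment_length G W i j"
  unfolding segment_length_def by (intro sum_nonneg len_nonneg) simp_all

lemma len_le_segment_length: "i \<le> j \<Longrightarrow> len G (W i) (W j) \<le> segment_length G W i j"
proof (induction j rule: dec_induct)
  case base
  then show ?case by (simp add: segment_length_def len_self)
next
  case (step j)
  then show ?case
    using len_triangle[of "W i" "W j" "W (Suc j)"] by (simp add: segment_length_def)
qed

text \<open>Between two visits of the vertex of weight 1 the walk reaches every vertex and comes back.\<close>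

lemma diameter_le:
  assumes "u \<in> verts G" "v \<in> verts G"
  shows "len G u v \<le> c"
proof -
  obtain r where r: "r \<in> verts G" "wt G r = 1" using unit_weight by blast
  \<comment> \<open>The walk goes from \<open>r\<close> to \<open>x\<close> and back within one gap
    of \<open>r\<close>, so \<open>x\<close> lies within \<open>c / 2\<close> of \<open>r\<close>;
    two such distances make up the diameter bound.\<close>
  have radius: "2 * len G r x \<le> c" if x: "x \<in> verts G" for x
  proof -
    obtain q where q: "W q = r" using occurs_after[OF r(1)] by metis
    obtain p where p: "q \<le> p" "W p = x" using occurs_after[OF x] by metis
    obtain i j where ij: "consecutive W r i j" "i \<le> p" "p < j"
      using consecutive_around[OF occurs_infinitely[OF r(1)] q p(1)] by metis
    have "2 * len G r x = len G (W i) (W p) + len G (W p) (W j)"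
      using ij(1) p(2) len_sym[OF r(1) x] by (simp add: consecutive_def)
    also have "\<dots> \<le> segment_length G W i p + segment_length G W p j"
      using ij by (intro add_mono len_le_segment_length) auto
    also have "\<dots> \<le> c"
      using consecutive_length[OF r(1) ij(1)] segment_length_split[of i p j G W] ij r(2) by simp
    finally show ?thesis .
  qed
  show ?thesis
    using radius[OF assms(1)] radius[OF assms(2)] len_triangle[OF assms(1) r(1) assms(2)]
      len_sym[OF assms(1) r(1)] by simp
qed

lemma c_nonneg: "0 \<le> c"
  using diameter_le[of "W 0" "W 0"] len_self[of "W 0"] by simp

text \<open>
  Start late enough that all of \<open>U\<close> has been visited before, and stop as soon as all of \<open>U\<close> has been
  visited again: the segment lies between two consecutive occurrences of the vertex reached last.
\<close>

lemma short_covering_segment: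
  assumes "U \<subseteq> verts G" and w: "0 < w" "\<And>v. v \<in> U \<Longrightarrow> w \<le> wt G v"
  shows "\<exists>a b. U \<subseteq> set (map W [a..<Suc b]) \<and> walk_length G (map W [a..<Suc b]) \<le> c / w"
proof (cases "U = {}")
  case True
  then show ?thesis using c_nonneg w(1)
    by (intro exI[of _ 0]) simp
next
  case False
  have fin: "finite U" using assms(1) finite_verts by (rule finite_subset)
  have "\<exists>p. W p = v" if "v \<in> U" for v using that assms(1) occurs_after by blast
  then obtain q where q: "\<And>v. v \<in> U \<Longrightarrow> W (q v) = v" by metis
  \<comment> \<open>Every vertex of \<open>U\<close> has an occurrence at or before
    \<open>a\<close>, as \<open>consecutive_around\<close> requires.\<close>
  define a where "a = Max (q ` U)"
  have qa: "q v \<le> a" if "v \<in> U" for v using that fin by (simp add: a_def)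
  have "\<exists>p\<ge>a. W p = v" if "v \<in> U" for v using that assms(1) occurs_after by blast
  then obtain p where p: "\<And>v. v \<in> U \<Longrightarrow> a \<le> p v \<and> W (p v) = v" by metis
  define b where "b = (LEAST b. U \<subseteq> W ` {a..b})"
  have "U \<subseteq> W ` {a..Max (p ` U)}"
  proof
    fix v assume "v \<in> U"
    then show "v \<in> W ` {a..Max (p ` U)}"
      using p[of v] fin by (intro image_eqI[of _ _ "p v"]) auto
  qed
  then have cover: "U \<subseteq> W ` {a..b}" unfolding b_def by (rule LeastI)
  then have "a \<le> b" using False by auto
  have "segment_length G W a b \<le> c / w"
  proof (cases "a = b")
    case True
    then show ?thesis using c_nonneg w(1) by (simp add: segment_length_def)
  next
    case ab: False
    then have "\<not> U \<subseteq> W ` {a..b - 1}"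
      using \<open>a \<le> b\<close> not_less_Least[of "b - 1" "\<lambda>b. U \<subseteq> W ` {a..b}"] unfolding b_def by auto
    then obtain v where v: "v \<in> U" "v \<notin> W ` {a..b - 1}" by blast
    have first: "W k \<noteq> v" if "a \<le> k" "k < b" for k
      using that v(2) by (metis Suc_pred' atLeastAtMost_iff image_eqI less_Suc_eq_le
          less_nat_zero_code not_gr_zero)
    obtain k where "a \<le> k" "k \<le> b" "W k = v" using cover v(1) by fastforce
    then have "W b = v" using first[of k] by (cases "k = b") auto
    have vG: "v \<in> verts G" using v(1) assms(1) by blast
    \<comment> \<open>From \<open>a\<close> on, \<open>v\<close> is first visited at
      \<open>b\<close>, so the gap of \<open>v\<close> around \<open>a\<close> ends exactly there
      and contains the whole segment.\<close>
    obtain i j where ij: "consecutive W v i j" "i \<le> a" "a < j"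
      using consecutive_around[OF occurs_infinitely[OF vG] q[OF v(1)] qa[OF v(1)]] by metis
    have "b \<le> j" using ij first[of j] by (metis consecutive_def leI less_imp_le)
    moreover have "j \<le> b"
      using ij ab \<open>a \<le> b\<close> \<open>W b = v\<close> unfolding consecutive_def by (metis leI le_neq_implies_less le_less_trans)
    ultimately have "j = b" by simp
    have "segment_length G W a b \<le> segment_length G W i b"
      using segment_length_split[of i a b G W] segment_length_nonneg[of i a] ij(2) \<open>a \<le> b\<close> by simp
    also have "\<dots> \<le> c / wt G v"
      using consecutive_length[OF vG ij(1)] \<open>j = b\<close> by simp
    also have "\<dots> \<le> c / w"
      using w v(1) c_nonneg by (intro divide_left_mono) (auto intro!: mult_pos_pos weights vG)
    finally show ?thesis .
  qed
  moreover have "U \<subseteq> set (map W [a..<Suc b])" using cover by (simp add: atLeastLessThanSuc_atLeastAtMost del: upt_Suc)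
  ultimately show ?thesis by (metis walk_length_segment)
qed

lemma tsp_path_class_le:
  assumes "tsp_path (induced G (weight_class G i)) P"
  shows "walk_length G P / 2 ^ i \<le> 2 * c"
proof -
  have sub: "weight_class G i \<subseteq> verts G" by (auto simp: weight_class_def)
  obtain a b where ab: "weight_class G i \<subseteq> set (map W [a..<Suc b])"
    "walk_length G (map W [a..<Suc b]) \<le> c / (1 / 2 ^ i)"
    using short_covering_segment[OF sub, of "1 / 2 ^ i"] by (auto simp: weight_class_def)
  have "walk_length G P \<le> walk_length G (map W [a..<Suc b]) + c"
    using sub ab(1) by (intro tsp_path_length_le[OF assms] c_nonneg diameter_le) auto
  \<comment> \<open>The second \<open>2 ^ i * c\<close> generously pays for the closing edge, of
    length at most \<open>c\<close>.\<close>
  also have "\<dots> \<le> 2 ^ i * c + 2 ^ i * c"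
    using ab(2) c_nonneg mult_right_mono[of 1 "2 ^ i" c] by (intro add_mono) (auto simp: mult.commute)
  finally show ?thesis by (simp add: field_simps)
qed

end

section \<open>Periodic concatenations of blocks\<close>

text \<open>The walks \<open>S\<^sub>1, ..., S\<^sub>t\<close> are continued periodically to all
  indices, so that windows of consecutive blocks may cross the end of a period. Single blocks may be
  empty, a whole period may not.\<close>

locale periodic_blocks =
  fixes B :: "nat \<Rightarrow> 'a list" and t :: nat
  assumes periodic: "B (k + t) = B k"
    and nonempty: "concat (map B [0..<t]) \<noteq> []"
begin

definition period_walk :: "'a list" where
  "period_walk = concat (map B [0..<t])"

text \<open>The position in the infinite walk at which block \<open>k\<close> starts.\<close>

definition offset :: "nat \<Rightarrow> nat" where
  "offset k = length (concat (map B [0..<k]))"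

lemma offset_0 [simp]: "offset 0 = 0"
  and offset_Suc [simp]: "offset (Suc k) = offset k + length (B k)"
  by (simp_all add: offset_def)

lemma mono_offset: "a \<le> b \<Longrightarrow> offset a \<le> offset b"
  by (rule lift_Suc_mono_le) auto

lemma offset_add_period: "offset (k + t) = offset k + offset t"
  by (induction k) (simp_all add: periodic)

lemma offset_period_pos: "0 < offset t"
  using nonempty by (simp add: offset_def)

text \<open>Each period adds at least one entry, so the offsets are unbounded and every position
  lies in some block.\<close>

lemma le_offset: "n \<le> offset (n * t)"
proof (induction n)
  case (Suc n)
  then show ?case
    using offset_add_period[of "n * t"] offset_period_pos by (simp add: add.commute)
qed simp

lemma repeat_walk_add_period: "repeat_walk period_walk (i + offset t) = repeat_walk period_walk i"
  by (simp add: repeat_walk_def period_walk_def offset_def)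

text \<open>Direct within the first period; a later index is lowered by \<open>t\<close>, which
  shifts the position by one period.\<close>

lemma repeat_walk_block:
  "r < length (B k) \<Longrightarrow> repeat_walk period_walk (offset k + r) = B k ! r"
proof (induction k rule: less_induct)
  case (less k)
  show ?case
  proof (cases "k < t")
    case True
    then have "[0..<t] = [0..<k] @ k # [Suc k..<t]"
      using upt_add_eq_append[of 0 k "t - k"] by (simp add: upt_conv_Cons)
    then have split: "period_walk = concat (map B [0..<k]) @ B k @ concat (map B [Suc k..<t])"
      by (simp add: period_walk_def)
    have "offset k + r < offset (Suc k)" using less.prems by simp
    also have "\<dots> \<le> length period_walk"
      using mono_offset[of "Suc k" t] True by (simp add: period_walk_def offset_def)
    finally have "repeat_walk period_walk (offset k + r) = period_walk ! (offset k + r)"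
      by (simp add: repeat_walk_def)
    also have "\<dots> = B k ! r"
      unfolding split offset_def using less.prems by (simp add: nth_append)
    finally show ?thesis .
  next
    case False
    have "t \<noteq> 0" using offset_period_pos by (intro notI) simp
    moreover obtain k' where "k = k' + t" using False by (metis add.commute le_add_diff_inverse not_less)
    ultimately show ?thesis
      using less.IH[of k'] less.prems repeat_walk_add_period[of "offset k' + r"]
      by (simp add: periodic offset_add_period ac_simps)
  qed
qed

lemma map_repeat_walk_blocks:
  assumes "a \<le> b"
  shows "map (repeat_walk period_walk) [offset a..<offset b] = concat (map B [a..<b])"
  using assms
proof (induction b rule: dec_induct)
  case base
  then show ?case by simp
next
  case (step b)
  have "map (repeat_walk period_walk) [offset b..<offset (Suc b)] = B b"
    by (intro nth_equalityI) (simp_all add: repeat_walk_block)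
  moreover have "[offset a..<offset (Suc b)] = [offset a..<offset b] @ [offset b..<offset (Suc b)]"
    using mono_offset[OF step.hyps(1)] by (metis le_add_diff_inverse offset_Suc upt_add_eq_append)
  ultimately show ?case using step by simp
qed

lemma block_of_position:
  obtains k where "offset k \<le> i" "i < offset (Suc k)"
proof -
  define k where "k = (LEAST k. i < offset (Suc k))"
  have "i < offset (Suc (Suc i * t))"
    using le_offset[of "Suc i"] mono_offset[of "Suc i * t" "Suc (Suc i * t)"] by simp
  then have "i < offset (Suc k)" unfolding k_def by (rule LeastI)
  moreover have "offset k \<le> i"
  proof (cases k)
    case (Suc k')
    then show ?thesis
      using not_less_Least[of k' "\<lambda>k. i < offset (Suc k)"] unfolding k_def[symmetric] by simp
  qed simp
  ultimately show thesis using that by blast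
qed

text \<open>The occurrence at \<open>i\<close> lies in some block \<open>k\<close>, and block
  \<open>k + p\<close> contains \<open>v\<close> again, so the next occurrence comes no later. The
  condition \<open>0 < p\<close> puts that second occurrence strictly after
  \<open>i\<close>.\<close>

lemma consecutive_in_blocks:
  assumes "consecutive (repeat_walk period_walk) v i j" "0 < p"
    and recur: "\<And>k. v \<in> set (B k) \<Longrightarrow> v \<in> set (B (k + p))"
  obtains k where "offset k \<le> i" "j < offset (Suc (k + p))"
proof -
  obtain k where k: "offset k \<le> i" "i < offset (Suc k)" by (rule block_of_position)
  then have "v = B k ! (i - offset k)" "i - offset k < length (B k)"
    using repeat_walk_block[of "i - offset k" k] assms(1) by (auto simp: consecutive_def)
  then obtain r where r: "r < length (B (k + p))" "B (k + p) ! r = v"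
    using recur[of k] by (auto simp: in_set_conv_nth)
  define q where "q = offset (k + p) + r"
  have "repeat_walk period_walk q = v" using r repeat_walk_block q_def by simp
  moreover have "i < q"
    using k(2) mono_offset[of "Suc k" "k + p"] assms(2) by (simp add: q_def)
  ultimately have "j \<le> q" using assms(1) unfolding consecutive_def by (metis leI)
  also have "q < offset (Suc (k + p))" using r(1) by (simp add: q_def)
  finally show thesis using that k(1) by blast
qed

lemma infinite_occurrences:
  assumes "v \<in> set period_walk"
  shows "infinite {i. repeat_walk period_walk i = v}"
proof -
  obtain r where r: "r < length period_walk" "period_walk ! r = v"
    using assms by (auto simp: in_set_conv_nth)
  have "inj (\<lambda>n. r + n * length period_walk)"
    using r(1) by (intro injI) auto
  then have "infinite (range (\<lambda>n. r + n * length period_walk))"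
    by (rule range_inj_infinite)
  then show ?thesis
    by (rule infinite_super[rotated]) (use r in \<open>auto simp: repeat_walk_def\<close>)
qed

lemma repeat_walk_in: "repeat_walk period_walk i \<in> set period_walk"
  using nonempty unfolding repeat_walk_def period_walk_def[symmetric]
  by (intro nth_mem mod_less_divisor) simp

text \<open>A gap of \<open>v\<close> fits into \<open>Suc p\<close> consecutive blocks, each
  charged at most \<open>K\<close> for itself and for the edge to the next block.\<close>

lemma latency_repeat_walk_le:
  assumes "metric_graph G" "\<And>k. set (B k) \<subseteq> verts G"
    and D: "0 \<le> D" "\<And>u v. u \<in> verts G \<Longrightarrow> v \<in> verts G \<Longrightarrow> len G u v \<le> D"
    and K: "\<And>k. walk_length G (B k) + D \<le> K"
    and v: "v \<in> set period_walk" "0 < p" "\<And>k. v \<in> set (B k) \<Longrightarrow> v \<in> set (B (k + p))"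
  shows "latency G (repeat_walk period_walk) v \<le> ereal (real (Suc p) * K)"
proof -
  interpret metric_weighted_graph G using assms(1) by unfold_locales
  let ?R = "repeat_walk period_walk"
  have R_in: "?R l \<in> verts G" for l
    using repeat_walk_in[of l] assms(2) by (auto simp: period_walk_def)
  have "segment_length G ?R i j \<le> real (Suc p) * K" if gap: "consecutive ?R v i j" for i j
  proof -
    obtain k where k: "offset k \<le> i" "j < offset (Suc (k + p))"
      using consecutive_in_blocks[OF gap v(2,3)] by metis
    \<comment> \<open>Extending the segment to whole blocks only adds nonnegative edges.\<close>
    have "segment_length G ?R i j \<le> walk_length G (map ?R [offset k..<offset (Suc (k + p))])"
      unfolding segment_length_def walk_length_map_upt
      using k by (intro sum_atLeastLessThan_mono_interval len_nonneg R_in) auto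
    also have "\<dots> = walk_length G (concat (map B [k..<Suc (k + p)]))"
      by (subst map_repeat_walk_blocks) auto
    also have "\<dots> \<le> (\<Sum>X\<leftarrow>map B [k..<Suc (k + p)]. walk_length G X + D)"
      using assms(2) by (intro walk_length_concat_le[OF D]) auto
    also have "\<dots> \<le> (\<Sum>X\<leftarrow>map B [k..<Suc (k + p)]. K)"
      using K by (intro sum_list_mono) auto
    also have "\<dots> = real (Suc p) * K"
      by (simp add: comp_def sum_list_triv algebra_simps del: upt_Suc)
    finally show ?thesis .
  qed
  then show ?thesis
    unfolding latency_le_iff using infinite_occurrences[OF v(1)] by blast
qed

end

section \<open>The output of the algorithm\<close>

lemma weight_class_Suc_less: "u \<in> weight_class G (Suc i) \<Longrightarrow> wt G u < 1 / 2 ^ i"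
  by (simp add: weight_class_def)

text \<open>The form \<open>2 / 2 ^ i\<close> also covers \<open>i = 0\<close>, where the exponent
  \<open>int i - 1\<close> is negative.\<close>

lemma weight_class_less: "u \<in> weight_class G i \<Longrightarrow> wt G u < 2 / 2 ^ i"
  by (cases i) (simp_all add: weight_class_def)

lemma weight_class_unique:
  assumes "u \<in> weight_class G i" "u \<in> weight_class G j"
  shows "i = j"
proof -
  have False if less: "i < j" and classes: "u \<in> weight_class G i" "u \<in> weight_class G j" for i j
  proof -
    obtain l where l: "j = Suc l" "i \<le> l" using less by (cases j) auto
    have "wt G u < 1 / 2 ^ l" using classes(2) unfolding l(1) by (rule weight_class_Suc_less)
    also have "\<dots> \<le> 1 / 2 ^ i" using l(2) by (simp add: frac_le)
    also have "\<dots> \<le> wt G u" using classes(1) by (simp add: weight_class_def)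
    finally show False by simp
  qed
  then show ?thesis using assms by (metis linorder_neqE_nat)
qed

text \<open>The class is given by the least \<open>i\<close> whose lower bound holds: failure at
  \<open>i - 1\<close> is exactly the upper bound. For \<open>i = 0\<close> the upper bound is 2,
  and \<open>wt G v \<le> 1\<close> suffices.\<close>

lemma weight_class_exists:
  assumes "v \<in> verts G" "1 / 2 ^ m \<le> wt G v" "wt G v \<le> 1"
  shows "\<exists>i\<le>m. v \<in> weight_class G i"
proof -
  define i where "i = (LEAST i. 1 / 2 ^ i \<le> wt G v)"
  have "1 / 2 ^ i \<le> wt G v" "i \<le> m"
    unfolding i_def using assms(2) by (rule LeastI, rule Least_le)
  moreover have "wt G v < 1 / 2 powi (int i - 1)"
  proof (cases i)
    case 0
    then show ?thesis using assms(3) by simp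
  next
    case (Suc l)
    then show ?thesis
      using not_less_Least[of l "\<lambda>i. 1 / 2 ^ i \<le> wt G v"] unfolding i_def[symmetric] by simp
  qed
  ultimately show ?thesis using assms(1) by (auto simp: weight_class_def)
qed

section \<open>One run of the algorithm with its choices fixed\<close>

locale brute_partition_run = metric_weighted_graph +
  fixes m :: nat and P :: "nat \<Rightarrow> 'a list" and Ws :: "nat \<Rightarrow> 'a list list"
  assumes wt_ge: "\<And>v. v \<in> verts G \<Longrightarrow> 1 / 2 ^ m \<le> wt G v"
    and wt_le: "\<And>v. v \<in> verts G \<Longrightarrow> wt G v \<le> 1"
    and tsp: "\<And>i. i \<le> m \<Longrightarrow> tsp_path (induced G (weight_class G i)) (P i)"
    and partition: "\<And>i. i \<le> m \<Longrightarrow> walk_partition G (P i) (2 ^ i) (Ws i)"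
begin

text \<open>The algorithm counts its walks from 1 and blocks are counted from 0, hence
  \<open>Suc k\<close>.\<close>

definition block :: "nat \<Rightarrow> 'a list" where
  "block k = concat (map (\<lambda>i. Ws i ! (Suc k mod 2 ^ i)) [0..<m + 1])"

lemma piece_in: "i \<le> m \<Longrightarrow> Ws i ! (k mod 2 ^ i) \<in> set (Ws i)"
  using partition[of i] by (simp add: walk_partition_def nth_mem)

lemma verts_class: "verts (induced G (weight_class G i)) = weight_class G i"
  by (auto simp: induced_def weight_class_def)

lemma set_P: "i \<le> m \<Longrightarrow> set (P i) = weight_class G i"
  and length_P: "i \<le> m \<Longrightarrow> length (P i) = card (weight_class G i)"
  using tsp verts_class by (metis tsp_pathE)+

lemma concat_Ws: "i \<le> m \<Longrightarrow> concat (Ws i) = P i"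
  using partition by (simp add: walk_partition_def)

lemma set_piece: "i \<le> m \<Longrightarrow> set (Ws i ! (k mod 2 ^ i)) \<subseteq> weight_class G i"
  using piece_in[of i k] concat_Ws[of i] set_P[of i] by (metis UN_upper set_concat)

text \<open>The weight classes are disjoint, so only the piece of class \<open>i\<close> can
  contribute \<open>v\<close>.\<close>

lemma in_block_iff:
  assumes "i \<le> m" "v \<in> weight_class G i"
  shows "v \<in> set (block k) \<longleftrightarrow> v \<in> set (Ws i ! (Suc k mod 2 ^ i))"
proof -
  have "v \<in> set (block k) \<longleftrightarrow> (\<exists>j\<le>m. v \<in> set (Ws j ! (Suc k mod 2 ^ j)))"
    by (auto simp: block_def less_Suc_eq_le simp del: upt_Suc)
  moreover have "j = i" if "j \<le> m" "v \<in> set (Ws j ! (Suc k mod 2 ^ j))" for j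
    using set_piece[OF that(1)] that(2) assms(2) by (intro weight_class_unique) auto
  ultimately show ?thesis using assms(1) by blast
qed

lemma block_recurs:
  assumes "i \<le> m" "v \<in> weight_class G i" "v \<in> set (block k)"
  shows "v \<in> set (block (k + 2 ^ i))"
  using assms(3) unfolding in_block_iff[OF assms(1,2)]
  by (metis add_Suc mod_add_self2)

lemma set_block: "set (block k) \<subseteq> verts G"
  using set_piece[of _ "Suc k"]
  by (fastforce simp: block_def less_Suc_eq_le weight_class_def simp del: upt_Suc)

text \<open>Every \<open>2 ^ i\<close> with \<open>i \<le> m\<close> divides
  \<open>2 ^ (m + 1)\<close>, so all piece indices repeat.\<close>

lemma block_periodic: "block (k + 2 ^ (m + 1)) = block k"
proof -
  have "Suc (k + 2 ^ (m + 1)) mod 2 ^ i = Suc k mod 2 ^ i" if "i < m + 1" for i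
  proof -
    have "(2 :: nat) ^ i dvd 2 ^ (m + 1)" using that by (intro le_imp_power_dvd) simp
    then show ?thesis by (metis add_Suc dvd_imp_mod_0 mod_add_right_eq add.right_neutral)
  qed
  then show ?thesis unfolding block_def by (intro arg_cong[of _ _ concat] map_cong) auto
qed

lemma verts_covered:
  assumes "v \<in> verts G"
  shows "v \<in> set (concat (map block [0..<2 ^ (m + 1)]))"
proof -
  obtain i where i: "i \<le> m" "v \<in> weight_class G i"
    using weight_class_exists[OF assms wt_ge[OF assms] wt_le[OF assms]] by blast
  then have "v \<in> set (concat (Ws i))" using set_P concat_Ws by simp
  then obtain x where x: "x < 2 ^ i" "v \<in> set (Ws i ! x)"
    using partition[OF i(1)] by (auto simp: in_set_conv_nth[of _ "Ws i"] walk_partition_def)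
  \<comment> \<open>Adding \<open>2 ^ i\<close> keeps \<open>Suc k\<close> congruent to
    \<open>x\<close> and avoids \<open>Suc k = 0\<close> when \<open>x = 0\<close>; the index still
    falls within the first period.\<close>
  define k where "k = x + 2 ^ i - 1"
  have "Suc k = x + 2 ^ i" by (simp add: k_def)
  then have "v \<in> set (block k)" using in_block_iff[OF i] x by simp
  moreover have "k < 2 ^ (m + 1)"
  proof -
    have "Suc k \<le> 2 ^ i + 2 ^ i" using x(1) \<open>Suc k = x + 2 ^ i\<close> by simp
    also have "\<dots> \<le> 2 ^ (m + 1)" using i(1) by (simp add: power_increasing mult_2[symmetric])
    finally show ?thesis by simp
  qed
  ultimately show ?thesis by auto
qed

sublocale periodic_blocks block "2 ^ (m + 1)"
proof
  show "block (k + 2 ^ (m + 1)) = block k" for k by (rule block_periodic)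
  show "concat (map block [0..<2 ^ (m + 1)]) \<noteq> []"
    using verts_covered verts_nonempty by (metis all_not_in_conv empty_set)
qed

lemma set_period_walk: "set period_walk = verts G"
  using set_block verts_covered unfolding period_walk_def by auto

text \<open>A block holds one piece of each class, a piece is no longer than the path through its
  class, and the classes are disjoint sets of vertices.\<close>

lemma length_block: "length (block k) \<le> card (verts G)"
proof -
  have piece: "length (Ws i ! (Suc k mod 2 ^ i)) \<le> card (weight_class G i)" if "i \<le> m" for i
  proof -
    have "length (Ws i ! (Suc k mod 2 ^ i)) \<le> length (concat (Ws i))"
      unfolding length_concat using piece_in[OF that] by (intro member_le_sum_list) auto
    then show ?thesis using that concat_Ws length_P by simp
  qed
  have "length (block k) = (\<Sum>i<m + 1. length (Ws i ! (Suc k mod 2 ^ i)))"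
    by (simp add: block_def length_concat comp_def interv_sum_list_conv_sum_set_nat
        atLeast0LessThan del: upt_Suc sum.lessThan_Suc)
  also have "\<dots> \<le> (\<Sum>i<m + 1. card (weight_class G i))"
    using piece by (intro sum_mono) auto
  also have "\<dots> = card (\<Union>i<m + 1. weight_class G i)"
  proof (intro card_UN_disjoint[symmetric] ballI impI)
    show "finite (weight_class G i)" for i
      using finite_verts by (simp add: weight_class_def)
    show "weight_class G i \<inter> weight_class G j = {}" if "i \<noteq> j" for i j
      using that weight_class_unique[of _ G i j] by blast
  qed simp
  also have "\<dots> \<le> card (verts G)"
    using finite_verts by (intro card_mono) (auto simp: weight_class_def)
  finally show ?thesis .
qed

lemma length_period_walk: "length period_walk \<le> 2 ^ (m + 1) * card (verts G)"
proof -
  have "length period_walk = (\<Sum>k<2 ^ (m + 1). length (block k))"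
    unfolding period_walk_def by (simp add: length_concat comp_def interv_sum_list_conv_sum_set_nat
        atLeast0LessThan del: upt_Suc)
  also have "\<dots> \<le> (\<Sum>k<(2::nat) ^ (m + 1). card (verts G))"
    using length_block by (intro sum_mono)
  finally show ?thesis by simp
qed

lemma cost_le:
  assumes "\<exists>v\<in>verts G. wt G v = 1" "infinite_walk G W" "cost G W \<le> ereal c"
  shows "0 \<le> c" "cost G (repeat_walk period_walk) \<le> ereal (16 * (real m + 1) * c)"
proof -
  have "0 < wt G v" if "v \<in> verts G" for v
    using wt_ge[OF that] by (rule less_le_trans[rotated]) simp
  then interpret W: walk_of_finite_cost G W c
    using assms by unfold_locales auto
  show "0 \<le> c" by (rule W.c_nonneg)
  \<comment> \<open>In each of the \<open>m + 1\<close> classes, \<open>2 * c\<close> bounds the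
    piece and \<open>c\<close> its connecting edge; the remaining share leaves room for the edge to
    the next block.\<close>
  define K where "K = 4 * (real m + 1) * c"
  have "0 \<le> K" using W.c_nonneg by (simp add: K_def)
  have block: "walk_length G (block k) + c \<le> K" for k
  proof -
    let ?Ls = "map (\<lambda>i. Ws i ! (Suc k mod 2 ^ i)) [0..<m + 1]"
    have "walk_length G (block k) \<le> (\<Sum>X\<leftarrow>?Ls. walk_length G X + c)"
      using set_block[of k] unfolding block_def
      by (intro walk_length_concat_le W.c_nonneg W.diameter_le) auto
    also have "\<dots> \<le> (\<Sum>X\<leftarrow>?Ls. 3 * c)"
    proof (intro sum_list_mono)
      fix X assume "X \<in> set ?Ls"
      then obtain i where i: "i \<le> m" "X = Ws i ! (Suc k mod 2 ^ i)"
        by (auto simp: less_Suc_eq_le simp del: upt_Suc)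
      have "walk_length G X \<le> walk_length G (P i) / 2 ^ i"
        using partition[OF i(1)] i(2) by (simp add: walk_partition_def)
      also have "\<dots> \<le> 2 * c" by (rule W.tsp_path_class_le[OF tsp[OF i(1)]])
      finally show "walk_length G X + c \<le> 3 * c" by simp
    qed
    also have "\<dots> = 3 * (real m + 1) * c"
      by (simp add: comp_def sum_list_triv algebra_simps del: upt_Suc)
    also have "\<dots> \<le> K - c"
      using mult_nonneg_nonneg[of "real m" c] W.c_nonneg by (simp add: K_def algebra_simps)
    finally show ?thesis by simp
  qed
  show "cost G (repeat_walk period_walk) \<le> ereal (16 * (real m + 1) * c)"
    unfolding cost_def
  proof (intro SUP_least)
    fix v assume v: "v \<in> verts G"
    obtain i where i: "i \<le> m" "v \<in> weight_class G i"
      using weight_class_exists[OF v wt_ge[OF v] wt_le[OF v]] by blast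
    have "v \<in> set period_walk" using v set_period_walk by simp
    then have "latency G (repeat_walk period_walk) v \<le> ereal (real (Suc (2 ^ i)) * K)"
      by (intro latency_repeat_walk_le[where D = c] metric set_block W.c_nonneg W.diameter_le block
          block_recurs[OF i]) simp_all
    then have "ereal (wt G v) * latency G (repeat_walk period_walk) v
        \<le> ereal (wt G v) * ereal (real (Suc (2 ^ i)) * K)"
      using W.weights[OF v] by (intro ereal_mult_left_mono) auto
    also have "\<dots> = ereal (wt G v * real (Suc (2 ^ i)) * K)" by simp
    also have "\<dots> \<le> ereal (4 * K)"
    proof -
      \<comment> \<open>The weight is below \<open>2 / 2 ^ i\<close> and a gap spans at most
        \<open>2 ^ i + 1 \<le> 2 * 2 ^ i\<close> blocks, hence the factor 4.\<close>
      have "wt G v * real (Suc (2 ^ i)) \<le> 2 / 2 ^ i * (2 * 2 ^ i)"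
        using weight_class_less[OF i(2)] W.weights[OF v] by (intro mult_mono) auto
      then show ?thesis using \<open>0 \<le> K\<close> by (simp add: mult_right_mono)
    qed
    also have "4 * K = 16 * (real m + 1) * c" by (simp add: K_def)
    finally show "ereal (wt G v) * latency G (repeat_walk period_walk) v
        \<le> ereal (16 * (real m + 1) * c)" .
  qed
qed

text \<open>The infimum need not be attained; after division by \<alpha> the bound is compared with
  each single cost and then passes to the infimum.\<close>

lemma cost_le_opt:
  assumes "\<exists>v\<in>verts G. wt G v = 1" "16 * (real m + 1) \<le> \<alpha>"
  shows "cost G (repeat_walk period_walk) \<le> ereal \<alpha> * opt G"
proof -
  have "0 < \<alpha>" using assms(2) by (intro less_le_trans[OF _ assms(2)]) simp
  have "cost G (repeat_walk period_walk) / ereal \<alpha> \<le> cost G W" if W: "infinite_walk G W" for W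
  proof (cases "cost G W")
    case (real c)
    have "16 * (real m + 1) * c \<le> \<alpha> * c"
      using assms(2) cost_le(1)[OF assms(1) W, of c] real by (intro mult_right_mono) auto
    then have "cost G (repeat_walk period_walk) \<le> ereal \<alpha> * ereal c"
      using cost_le(2)[OF assms(1) W, of c] real by (simp add: order_trans)
    then show ?thesis using \<open>0 < \<alpha>\<close> real by (simp add: ereal_divide_le_pos mult.commute)
  next
    case PInf
    then show ?thesis by simp
  next
    case MInf
    \<comment> \<open>A cost of \<open>-\<infinity>\<close> would be at most -1, whereas every real
      upper bound on a cost is nonnegative.\<close>
    then show ?thesis using cost_le(1)[OF assms(1) W, of "-1"] by simp
  qed
  then have "cost G (repeat_walk period_walk) / ereal \<alpha> \<le> opt G"
    unfolding opt_def by (intro INF_greatest) simp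
  then show ?thesis using \<open>0 < \<alpha>\<close> by (simp add: ereal_divide_le_pos mult.commute)
qed

end

text \<open>Extracts the choices hidden in the relation and shifts the indices \<open>1..t\<close>
  of the walks to the blocks \<open>0..t - 1\<close>.\<close>

lemma brute_partition_algE:
  assumes "metric_graph G" "brute_partition_alg G S"
    and "m = nat \<lceil>log 2 (weight_ratio G)\<rceil>"
    and "\<And>v. v \<in> verts G \<Longrightarrow> 1 / 2 ^ m \<le> wt G v \<and> wt G v \<le> 1"
  obtains P Ws where "brute_partition_run G m P Ws"
    "S = periodic_blocks.period_walk (brute_partition_run.block m Ws) (2 ^ (m + 1))"
proof -
  obtain P Ws where run:
    "\<forall>i\<le>m. tsp_path (induced G (weight_class G i)) (P i) \<and> walk_partition G (P i) (2 ^ i) (Ws i)"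
    and S: "S = concat (map (\<lambda>k. concat (map (\<lambda>i. Ws i ! (k mod 2 ^ i)) [0..<m + 1]))
      [1..<2 ^ (m + 1) + 1])"
    using assms(2) unfolding brute_partition_alg_def Let_def assms(3)[symmetric] by blast
  interpret brute_partition_run G m P Ws
    using assms(1,4) run by unfold_locales auto
  have "[1..<2 ^ (m + 1) + 1] = map Suc [0..<2 ^ (m + 1)]" by (simp add: map_Suc_upt)
  then have "S = period_walk"
    unfolding S period_walk_def block_def by (simp add: comp_def del: upt_Suc)
  then show thesis using that brute_partition_run_axioms by blast
qed

text \<open>The unit weight makes the maximum 1, so the ratio is the reciprocal of the least
  weight.\<close>

lemma weight_ratio_properties:
  assumes "metric_graph G" "\<And>v. v \<in> verts G \<Longrightarrow> 0 < wt G v \<and> wt G v \<le> 1"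
    and "\<exists>v\<in>verts G. wt G v = 1"
  shows "1 \<le> weight_ratio G" "v \<in> verts G \<Longrightarrow> 1 / weight_ratio G \<le> wt G v"
proof -
  interpret metric_weighted_graph G using assms(1) by unfold_locales
  have fin: "finite (wt G ` verts G)" "wt G ` verts G \<noteq> {}"
    using finite_verts verts_nonempty by auto
  have "Max (wt G ` verts G) = 1"
    using assms(2,3) fin by (intro Max_eqI) (auto intro: rev_image_eqI)
  then have ratio: "weight_ratio G = 1 / Min (wt G ` verts G)" by (simp add: weight_ratio_def)
  obtain u where "u \<in> verts G" "Min (wt G ` verts G) = wt G u"
    using Min_in[OF fin] by auto
  then show "1 \<le> weight_ratio G" using assms(2) ratio by simp
  show "1 / weight_ratio G \<le> wt G v" if "v \<in> verts G"
    using that fin unfolding ratio by simp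
qed

text \<open>Rounding up adds at most 1 to the logarithm, hence at most a factor 2 to the power.
  Since \<open>1 \<le> x\<close>, the logarithm is nonnegative and \<open>nat\<close> does not
  truncate.\<close>

lemma pow2_nat_ceiling_log_bounds:
  fixes x :: real
  assumes "1 \<le> x" "m = nat \<lceil>log 2 x\<rceil>"
  shows "x \<le> 2 ^ m" "2 ^ m \<le> 2 * x" "real m \<le> log 2 x + 1"
proof -
  have "0 \<le> log 2 x" using assms(1) by simp
  then show m: "real m \<le> log 2 x + 1" using assms(2) by linarith
  have "log 2 x \<le> real m" using \<open>0 \<le> log 2 x\<close> assms(2) by linarith
  then show "x \<le> 2 ^ m" using assms(1) by (simp add: log_le_iff powr_realpow)
  have "(2::real) ^ m = 2 powr real m" by (simp add: powr_realpow)
  also have "\<dots> \<le> 2 powr (log 2 x + 1)" using m by simp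
  also have "\<dots> = 2 * x" using assms(1) by (simp add: powr_add)
  finally show "2 ^ m \<le> 2 * x" .
qed

text \<open>For \<open>2 \<le> x\<close> the logarithm is at least 1 and absorbs the additive 2,
  giving \<open>16 * 3 = 48\<close>. The additive term keeps the factor positive at ratio 1, where
  the logarithm vanishes.\<close>

lemma log2_plus_const_bigo: "(\<lambda>x::real. 16 * (log 2 x + 2)) \<in> O(\<lambda>x. log 2 x)"
proof (rule bigoI[of _ 48])
  show "\<forall>\<^sub>F x in at_top. norm (16 * (log 2 x + 2)) \<le> 48 * norm (log 2 x)"
    using eventually_ge_at_top[of "2::real"]
  proof eventually_elim
    case (elim x)
    then have "1 \<le> log 2 x" by (simp add: le_log_iff)
    then show ?case by simp
  qed
qed

theorem theorem5p2:
  shows "\<exists>(c::real) (\<alpha>::real \<Rightarrow> real). \<alpha> \<in> O(\<lambda>x. log 2 x) \<and>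
    (\<forall>G::'a weighted_graph.
       metric_graph G \<and> (\<forall>v\<in>verts G. 0 < wt G v \<and> wt G v \<le> 1) \<and> (\<exists>v\<in>verts G. wt G v = 1) \<longrightarrow>
       (\<exists>S. brute_partition_alg G S) \<and>
       (\<forall>S. brute_partition_alg G S \<longrightarrow>
          walk G S \<and>
          real (length S) \<le> c * (real (card (verts G)) * weight_ratio G) \<and>
          approx_solution G (\<alpha> (weight_ratio G)) (repeat_walk S)))"
proof (rule exI[of _ 4], rule exI[of _ "\<lambda>x. 16 * (log 2 x + 2)"], intro conjI allI impI)
  show "(\<lambda>x::real. 16 * (log 2 x + 2)) \<in> O(\<lambda>x. log 2 x)" by (rule log2_plus_const_bigo)
next
  fix G :: "'a weighted_graph"
  assume G: "metric_graph G \<and> (\<forall>v\<in>verts G. 0 < wt G v \<and> wt G v \<le> 1) \<and> (\<exists>v\<in>verts G. wt G v = 1)"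
  then show "\<exists>S. brute_partition_alg G S"
    by (intro metric_weighted_graph.ex_brute_partition_alg) (simp add: metric_weighted_graph_def)
  fix S assume S: "brute_partition_alg G S"
  define m where "m = nat \<lceil>log 2 (weight_ratio G)\<rceil>"
  have ratio: "1 \<le> weight_ratio G" "\<And>v. v \<in> verts G \<Longrightarrow> 1 / weight_ratio G \<le> wt G v"
    using weight_ratio_properties[of G] G by auto
  note m = pow2_nat_ceiling_log_bounds[OF ratio(1) m_def]
  have "1 / 2 ^ m \<le> wt G v" if "v \<in> verts G" for v
    using ratio(1) m(1) by (intro order_trans[OF _ ratio(2)[OF that]] frac_le) auto
  then obtain P Ws where run: "brute_partition_run G m P Ws"
    and S_eq: "S = periodic_blocks.period_walk (brute_partition_run.block m Ws) (2 ^ (m + 1))"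
    using brute_partition_algE[OF _ S m_def] G by metis
  interpret brute_partition_run G m P Ws by (rule run)
  show "walk G S" unfolding walk_def S_eq set_period_walk ..
  have "real (length S) \<le> real (2 ^ (m + 1) * card (verts G))"
    using length_period_walk unfolding S_eq by (rule of_nat_mono)
  also have "\<dots> = 2 * real (card (verts G)) * 2 ^ m" by simp
  \<comment> \<open>The constant 4 has one factor 2 from \<open>2 ^ (m + 1)\<close> and one from
    rounding the logarithm up.\<close>
  also have "\<dots> \<le> 2 * real (card (verts G)) * (2 * weight_ratio G)"
    using m(2) by (intro mult_left_mono) auto
  finally show "real (length S) \<le> 4 * (real (card (verts G)) * weight_ratio G)" by simp
  have "infinite_walk G (repeat_walk S)"
    using repeat_walk_in unfolding infinite_walk_def S_eq set_period_walk by blast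
  \<comment> \<open>The summand 2 arises because \<open>m + 1\<close> is at most
    \<open>log 2 (weight_ratio G) + 2\<close>.\<close>
  moreover have "cost G (repeat_walk S) \<le> ereal (16 * (log 2 (weight_ratio G) + 2)) * opt G"
    unfolding S_eq using G m(3) by (intro cost_le_opt) auto
  ultimately show "approx_solution G (16 * (log 2 (weight_ratio G) + 2)) (repeat_walk S)"
    unfolding approx_solution_def ..
qed

end
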